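(* For all integers $t \geq k \geq 3$ there exists a nonempty $k$-uniform hypergraph $\mathcal{H}$ with a degree bound $d$ such that $$d \leq \binom{t}{k-1} + \binom{t+1 - \left\lceil \frac{t+2}{k} \right\rceil}{k-2}$$ and $$\frac{|\sigma(\mathcal{H})|}{|\mathcal{H}|} < \frac{k}{t-k+2}.$$
   Context: A $k$-uniform hypergraph on $[n]=\{1,\ldots,n\}$ ($n$ a positive integer) is a family $\mathcal{H} \subset \binom{[n]}{k}$ of $k$-element subsets of $[n]$, called hyperedges; $|\mathcal{H}|$ is the number of hyperedges. The shadow of $\mathcal{H}$ is $\sigma(\mathcal{H}) = \{S \in \binom{[n]}{k-1} : \exists H \in \mathcal{H},\ S \subset H\}$. The maximum degree is $\Delta(\mathcal{H}) = \max_{v \in [n]} |\{H \in \mathcal{H} : v \in H\}|$, and a degree bound of $\mathcal{H}$ is any real number $d$ with $\Delta(\mathcal{H}) \leq d$. *)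

theory Defs
  imports Complex_Main "HOL-Library.Ramsey"
begin

definition uniform_hypergraph :: "nat \<Rightarrow> nat \<Rightarrow> nat set set \<Rightarrow> bool" where
  "uniform_hypergraph n k H \<longleftrightarrow> n \<ge> 1 \<and> H \<subseteq> nsets {1..n} k"

definition shadow :: "nat \<Rightarrow> nat \<Rightarrow> nat set set \<Rightarrow> nat set set" where
  "shadow n k H = {S \<in> nsets {1..n} (k - 1). \<exists>e\<in>H. S \<subset> e}"

(* Only meaningful for n \<ge> 1: otherwise this is Max of the empty set. *)
definition max_degree :: "nat \<Rightarrow> nat set set \<Rightarrow> nat" where
  "max_degree n H = Max ((\<lambda>v. card {e \<in> H. v \<in> e}) ` {1..n})"

definition degree_bound :: "nat \<Rightarrow> nat set set \<Rightarrow> real \<Rightarrow> bool" where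
  "degree_bound n H d \<longleftrightarrow> real (max_degree n H) \<le> d"

end

theory Submission
  imports Defs
begin

text \<open>
  The complete \<open>k\<close>-uniform hypergraph on \<open>t + 1\<close> vertices has all degrees \<open>t choose (k - 1)\<close> and
  shadow ratio exactly \<open>k / (t - k + 2)\<close>. It suffices to enlarge it by edges whose own ratio
  (new shadow sets per new edge) is strictly smaller. One new vertex is added whose link is the
  complete \<open>(k - 1)\<close>-uniform hypergraph on \<open>s + 1\<close> old vertices, where
  \<open>s = t + 1 - \<lceil>(t + 2) / k\<rceil>\<close>. An old vertex gains at most \<open>s choose (k - 2)\<close> in degree.
  The \<open>(s + 1) choose (k - 1)\<close> new edges create only the \<open>(s + 1) choose (k - 2)\<close> new shadow sets
  that contain the new vertex, because the members of its link already were in the shadow; their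
  ratio is \<open>(k - 1) / (s - k + 3)\<close>. It is smaller than \<open>k / (t - k + 2)\<close> precisely when
  \<open>s > t - (t + 2) / k\<close>, and \<open>s\<close> is the least integer with this property.
  The degrees are bounded in \<open>max_degree_apex_le\<close>, the shadow in \<open>card_shadow_apex_le\<close>, and the
  ratios are compared in \<open>mediant_binomial_less\<close>.
\<close>

definition apex_hypergraph :: "nat \<Rightarrow> nat \<Rightarrow> nat \<Rightarrow> nat set set" where
  "apex_hypergraph k p q = nsets {1..p} k \<union> insert (Suc p) ` nsets {1..q} (k - 1)"

lemma card_nsets_containing_le:
  assumes "finite A"
  shows "card {e \<in> nsets A (Suc r). v \<in> e} \<le> (card A - 1) choose r"
proof (cases "v \<in> A")
  case True
  have "{e \<in> nsets A (Suc r). v \<in> e} \<subseteq> insert v ` nsets (A - {v}) r"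
  proof
    fix e assume e: "e \<in> {e \<in> nsets A (Suc r). v \<in> e}"
    then have "e - {v} \<in> nsets (A - {v}) r" and "e = insert v (e - {v})"
      by (auto simp: nsets_def)
    then show "e \<in> insert v ` nsets (A - {v}) r" by (rule image_eqI[rotated])
  qed
  then have "card {e \<in> nsets A (Suc r). v \<in> e} \<le> card (nsets (A - {v}) r)"
    using assms by (meson card_image_le card_mono finite_Diff finite_imageI finite_imp_finite_nsets order_trans)
  with assms True show ?thesis by simp
next
  case False
  then have none: "{e \<in> nsets A (Suc r). v \<in> e} = {}" by (auto simp: nsets_def)
  show ?thesis unfolding none by simp
qed

lemma uniform_hypergraph_apex:
  assumes "q \<le> p" and "k \<ge> 1"
  shows "uniform_hypergraph (Suc p) k (apex_hypergraph k p q)"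
proof -
  have "insert (Suc p) e \<in> nsets {1..Suc p} k" if "e \<in> nsets {1..q} (k - 1)" for e
  proof -
    have "Suc p \<notin> e" using that assms(1) by (auto simp: nsets_def)
    then show ?thesis using that assms by (auto simp: nsets_def)
  qed
  moreover have "nsets {1..p} k \<subseteq> nsets {1..Suc p} k" by (rule nsets_mono) auto
  ultimately show ?thesis by (auto simp: uniform_hypergraph_def apex_hypergraph_def)
qed

lemma card_apex_hypergraph:
  assumes "q \<le> p"
  shows "card (apex_hypergraph k p q) = (p choose k) + (q choose (k - 1))"
proof -
  have fresh: "Suc p \<notin> e" if "e \<in> nsets {1..q} (k - 1)" for e
    using that assms by (auto simp: nsets_def)
  have "inj_on (insert (Suc p)) (nsets {1..q} (k - 1))"
    by (rule inj_onI) (use fresh in \<open>metis insert_ident\<close>)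
  then have "card (insert (Suc p) ` nsets {1..q} (k - 1)) = q choose (k - 1)"
    by (simp add: card_image)
  moreover have "nsets {1..p} k \<inter> insert (Suc p) ` nsets {1..q} (k - 1) = {}"
    by (auto simp: nsets_def)
  ultimately show ?thesis
    by (simp add: apex_hypergraph_def card_Un_disjoint finite_imp_finite_nsets)
qed

text \<open>
  A shadow set that avoids the apex is an \<open>(r + 1)\<close>-subset of the base. One that contains the apex
  can only come from an edge through the apex, so the rest of it is an \<open>r\<close>-subset of a set in the link.
\<close>

lemma card_shadow_apex_le:
  assumes "q \<le> p"
  shows "card (shadow (Suc p) (Suc (Suc r)) (apex_hypergraph (Suc (Suc r)) p q))
    \<le> (p choose Suc r) + (q choose r)"
proof -
  let ?T = "nsets {1..p} (Suc r) \<union> insert (Suc p) ` nsets {1..q} r"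
  have "shadow (Suc p) (Suc (Suc r)) (apex_hypergraph (Suc (Suc r)) p q) \<subseteq> ?T"
  proof
    fix S assume "S \<in> shadow (Suc p) (Suc (Suc r)) (apex_hypergraph (Suc (Suc r)) p q)"
    then obtain e where S: "S \<in> nsets {1..Suc p} (Suc r)" and e: "S \<subset> e"
      and eH: "e \<in> apex_hypergraph (Suc (Suc r)) p q"
      by (auto simp: shadow_def)
    show "S \<in> ?T"
    proof (cases "Suc p \<in> S")
      case False
      then have "S \<subseteq> {1..p}" using S by (auto simp: nsets_def le_Suc_eq)
      then show ?thesis using S by (auto simp: nsets_def)
    next
      case True
      with e have "Suc p \<in> e" by blast
      moreover have "Suc p \<notin> f" if "f \<in> nsets {1..p} (Suc (Suc r))" for f
        using that by (auto simp: nsets_def)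
      ultimately obtain L where L: "L \<in> nsets {1..q} (Suc r)" and "e = insert (Suc p) L"
        using eH unfolding apex_hypergraph_def by auto
      with e have "S - {Suc p} \<subseteq> L" by blast
      with L True S have "S - {Suc p} \<in> nsets {1..q} r"
        unfolding nsets_def mem_Collect_eq by (metis card_Diff_singleton diff_Suc_1
            finite_Diff order_trans)
      moreover have "S = insert (Suc p) (S - {Suc p})" using True by blast
      ultimately show ?thesis by (metis UnI2 image_eqI)
    qed
  qed
  then have "card (shadow (Suc p) (Suc (Suc r)) (apex_hypergraph (Suc (Suc r)) p q)) \<le> card ?T"
    by (intro card_mono) (auto simp: finite_imp_finite_nsets)
  also have "\<dots> \<le> card (nsets {1..p} (Suc r)) + card (insert (Suc p) ` nsets {1..q} r)"
    by (rule card_Un_le)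
  also have "\<dots> \<le> (p choose Suc r) + (q choose r)"
    using card_image_le[of "nsets {1..q} r" "insert (Suc p)"] by (simp add: finite_imp_finite_nsets)
  finally show ?thesis .
qed

text \<open>
  The apex has degree \<open>(s + 1) choose (r + 1)\<close>, which Pascal's rule splits into two terms bounded by
  those of the claim; an old vertex has its degree in the base plus its degree in the link.
\<close>

lemma max_degree_apex_le:
  assumes "s \<le> t"
  shows "max_degree (Suc (Suc t)) (apex_hypergraph (Suc (Suc r)) (Suc t) (Suc s))
    \<le> (t choose Suc r) + (s choose r)"
proof -
  let ?H = "apex_hypergraph (Suc (Suc r)) (Suc t) (Suc s)"
  let ?w = "Suc (Suc t)"
  have "card {e \<in> ?H. v \<in> e} \<le> (t choose Suc r) + (s choose r)" for v
  proof (cases "v = ?w")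
    case True
    have "?w \<notin> f" if "f \<in> nsets {1..Suc t} (Suc (Suc r))" for f
      using that by (auto simp: nsets_def)
    then have "{e \<in> ?H. v \<in> e} \<subseteq> insert ?w ` nsets {1..Suc s} (Suc r)"
      using True unfolding apex_hypergraph_def by auto
    then have "card {e \<in> ?H. v \<in> e} \<le> card (nsets {1..Suc s} (Suc r))"
      by (meson card_image_le card_mono finite_atLeastAtMost finite_imageI finite_imp_finite_nsets
          order_trans)
    also have "\<dots> = (s choose Suc r) + (s choose r)" by simp
    also have "\<dots> \<le> (t choose Suc r) + (s choose r)"
      using assms by (simp add: binomial_right_mono)
    finally show ?thesis .
  next
    case False
    let ?B = "{e \<in> nsets {1..Suc t} (Suc (Suc r)). v \<in> e}"
    let ?L = "{e \<in> nsets {1..Suc s} (Suc r). v \<in> e}"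
    have fin: "finite ?B" "finite ?L" by (auto simp: finite_imp_finite_nsets)
    have "{e \<in> ?H. v \<in> e} \<subseteq> ?B \<union> insert ?w ` ?L"
      using False by (auto simp: apex_hypergraph_def)
    then have "card {e \<in> ?H. v \<in> e} \<le> card (?B \<union> insert ?w ` ?L)"
      using fin by (intro card_mono) auto
    also have "\<dots> \<le> card ?B + card ?L"
      using card_Un_le[of ?B "insert ?w ` ?L"] card_image_le[OF fin(2), of "insert ?w"] by linarith
    also have "\<dots> \<le> (t choose Suc r) + (s choose r)"
      using card_nsets_containing_le[of "{1..Suc t}" "Suc r" v]
        card_nsets_containing_le[of "{1..Suc s}" r v] by simp
    finally show ?thesis .
  qed
  then show ?thesis by (auto simp: max_degree_def)
qed

lemma binomial_step_ratio:
  assumes "k \<le> n"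
  shows "(real n - real k) * real (n choose k) = real (Suc k) * real (n choose Suc k)"
proof -
  have "(n - k) * (n choose k) = Suc k * (n choose Suc k)"
    by (simp only: binomial_absorb_comp binomial_absorption)
  then have "real (n - k) * real (n choose k) = real (Suc k) * real (n choose Suc k)"
    by (metis of_nat_mult)
  then show ?thesis using assms by simp
qed

text \<open>
  The left-hand side is the mediant of the ratios of the base, \<open>(r + 2) / (t - r)\<close>, and of the
  link of the apex, \<open>(r + 1) / (s + 1 - r)\<close>. The hypothesis \<open>less\<close> says that the second ratio is
  strictly below the first, and then so is the mediant.
\<close>

lemma mediant_binomial_less:
  assumes "Suc r \<le> t"
    and less: "real (Suc r) * (real t - real r) < real (Suc (Suc r)) * (real s + 1 - real r)"
  shows "real ((Suc t choose Suc r) + (Suc s choose r))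
      / real ((Suc t choose Suc (Suc r)) + (Suc s choose Suc r))
    < real (Suc (Suc r)) / (real t - real r)"
proof -
  define x where "x = real t - real r"
  define y where "y = real s + 1 - real r"
  have x: "x > 0" using assms(1) by (simp add: x_def)
  have "0 < real (Suc r) * x" using x by simp
  also have "\<dots> < real (Suc (Suc r)) * y" using less by (simp add: x_def y_def)
  finally have y: "y > 0" by (simp add: zero_less_mult_iff)
  then have rs: "r \<le> s" by (simp add: y_def)
  have base: "x * real (Suc t choose Suc r) = real (Suc (Suc r)) * real (Suc t choose Suc (Suc r))"
    using binomial_step_ratio[of "Suc r" "Suc t"] assms(1) by (simp add: x_def)
  have link: "y * real (Suc s choose r) = real (Suc r) * real (Suc s choose Suc r)"
    using binomial_step_ratio[of r "Suc s"] rs by (simp add: y_def algebra_simps)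
  have pos: "real (Suc s choose Suc r) > 0" using rs by (simp del: binomial_Suc_Suc)
  have "y * (x * real (Suc s choose r)) = (real (Suc r) * x) * real (Suc s choose Suc r)"
    using link by (simp add: mult.left_commute mult.assoc)
  also have "\<dots> < (real (Suc (Suc r)) * y) * real (Suc s choose Suc r)"
    using less pos unfolding x_def y_def by (rule mult_strict_right_mono)
  finally have "y * (x * real (Suc s choose r)) < y * (real (Suc (Suc r)) * real (Suc s choose Suc r))"
    by (simp only: mult_ac)
  with y have "x * real (Suc s choose r) < real (Suc (Suc r)) * real (Suc s choose Suc r)"
    by (simp only: mult_less_cancel_left_pos)
  with base have "x * real ((Suc t choose Suc r) + (Suc s choose r))
      < real (Suc (Suc r)) * real ((Suc t choose Suc (Suc r)) + (Suc s choose Suc r))"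
    by (simp only: of_nat_add distrib_left)
  moreover have "real ((Suc t choose Suc (Suc r)) + (Suc s choose Suc r)) > 0"
    using pos by linarith
  ultimately show ?thesis
    using x unfolding x_def[symmetric]
    by (simp only: pos_divide_less_eq pos_less_divide_eq times_divide_eq_left) (simp only: mult_ac)
qed

theorem proposition1p6:
  fixes t k :: nat
  assumes "t \<ge> k" and "k \<ge> 3"
  shows "\<exists>(n::nat) (H::nat set set) (d::real).
           uniform_hypergraph n k H \<and> H \<noteq> {} \<and> degree_bound n H d \<and>
           d \<le> real (t choose (k - 1))
                + real ((t + 1 - nat \<lceil>real (t + 2) / real k\<rceil>) choose (k - 2)) \<and>
           real (card (shadow n k H)) / real (card H) < real k / (real t - real k + 2)"
proof -
  define r where "r = k - 2"
  have k: "k = Suc (Suc r)" using assms(2) by (simp add: r_def)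
  define m where "m = nat \<lceil>real (t + 2) / real k\<rceil>"
  define s where "s = t + 1 - m"
  have quot: "0 < real (t + 2) / real k" using k by simp
  then have m_pos: "1 \<le> m" unfolding m_def by linarith
  have m_less: "real m < real (t + 2) / real k + 1" unfolding m_def using quot by linarith
  \<comment> \<open>Truncated subtraction can only enlarge \<open>s\<close>, which is the direction used here.\<close>
  have "real s \<ge> real t + 1 - real m" unfolding s_def by linarith
  with m_less have "real t - real s < real (t + 2) / real k" by linarith
  then have "(real t - real s) * real k < real (t + 2)"
    using k by (simp add: pos_less_divide_eq)
  then have less: "real (Suc r) * (real t - real r) < real (Suc (Suc r)) * (real s + 1 - real r)"
    unfolding k by (simp add: algebra_simps)
  have st: "s \<le> t" using m_pos by (simp add: s_def)
  have rt: "Suc r \<le> t" using assms(1) k by simp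
  let ?H = "apex_hypergraph k (Suc t) (Suc s)"
  let ?n = "Suc (Suc t)"
  have card_H: "card ?H = (Suc t choose k) + (Suc s choose Suc r)"
    using card_apex_hypergraph[of "Suc s" "Suc t" k] st k by simp
  have "Suc t choose k > 0" using assms(1) by simp
  with card_H have "?H \<noteq> {}" by auto
  moreover have "uniform_hypergraph ?n k ?H"
    using st k by (intro uniform_hypergraph_apex) auto
  moreover have "degree_bound ?n ?H (real (t choose Suc r) + real (s choose r))"
    unfolding degree_bound_def k using max_degree_apex_le[OF st, of r] by linarith
  moreover have "real (card (shadow ?n k ?H)) / real (card ?H) < real k / (real t - real k + 2)"
  proof -
    have "card (shadow ?n k ?H) \<le> (Suc t choose Suc r) + (Suc s choose r)"
      using card_shadow_apex_le[of "Suc s" "Suc t" r] st unfolding k by simp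
    then have "real (card (shadow ?n k ?H)) / real (card ?H)
        \<le> real ((Suc t choose Suc r) + (Suc s choose r)) / real (card ?H)"
      by (intro divide_right_mono) (simp_all only: of_nat_le_iff of_nat_0_le_iff)
    also have "\<dots> < real k / (real t - real r)"
      unfolding card_H using mediant_binomial_less[OF rt less] unfolding k .
    also have "real t - real r = real t - real k + 2" by (simp add: k)
    finally show ?thesis .
  qed
  ultimately show ?thesis
    unfolding m_def[symmetric] s_def[symmetric] using k
    by (intro exI[of _ ?n] exI[of _ ?H] exI[of _ "real (t choose Suc r) + real (s choose r)"]) simp
qed

end
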